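(* Let $(X,\mathcal{B}_X)$ be a bornological space, $(L,\mathcal{B}_L)$ a bornological group and $\rho$ a bornological $L$-action on $X$. Let $\mathcal{E}$ be a coarse structure on $X$ such that $\mathcal{B}_X=\mathcal{B}_{\mathcal{E}}$, and assume that the $L$-action $\rho$ on $(X,\mathcal{E})$ is equi controlled. Then the following conditions are equivalent. (1) The action $\rho$ is bornological proper. (2) For every point $x\in X$, the isotropy $L_x=\{l\in L\mid lx=x\}$ belongs to $\mathcal{B}_L$, and the equality $\iota_x^*(\mathcal{B}_{\mathcal{E}})=T^x_*(\mathcal{B}_L)$ of bornologies on the orbit $L\cdot x$ holds.
   Context: A bornology on a set $X$ is a family $\mathcal{B}$ of subsets of $X$ with $\bigcup_{B\in\mathcal{B}}B=X$ that is closed under unions of two members and under passing to subsets; $(X,\mathcal{B})$ is then a bornological space. A map between bornological spaces is bornological if the image of every member of the source bornology is a member of the target bornology. The direct product bornology on $X\times Y$ consists of all subsets of sets $B\times D$ with $B\in\mathcal{B}_X$, $D\in\mathcal{B}_Y$. A bornological group is a group $L$ with a bornology $\mathcal{B}_L$ such that multiplication $L\times L\to L$ (direct product bornology on $L\times L$) and inversion $L\to L$ are bornological maps. An $L$-action on $(X,\mathcal{B}_X)$ is bornological if the action map $L\times X\to X$, $(l,x)\mapsto lx$, is bornological (direct product bornology on $L\times X$). A bornological action $\rho$ is bornological proper if $L_{B,B'}:=\{l\in L\mid lB\cap B'\neq\emptyset\}\in\mathcal{B}_L$ for all $B,B'\in\mathcal{B}_X$. A coarse structure on $X$ is a family $\mathcal{E}$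 of subsets of $X\times X$ containing $\mathrm{diag}(X)=\{(x,x)\mid x\in X\}$ and closed under transposition $E^T=\{(x',x)\mid (x,x')\in E\}$, unions of two members, compositions $E_1\circ E_2=\{(x,z)\mid \exists y\in X,\ (x,y)\in E_1,\ (y,z)\in E_2\}$, and subsets. For $E\subset X\times X$ and $A\subset X$, $E[A]=\{y\in X\mid \exists a\in A,\ (y,a)\in E\}$. The induced bornology is $\mathcal{B}_{\mathcal{E}}=\{B\subset X\mid \exists A\subset X\text{ finite},\ \exists E\in\mathcal{E},\ B\subset E[A]\}$. An $L$-action on $(X,\mathcal{E})$ is equi controlled if for each $E\in\mathcal{E}$ there is $F\in\mathcal{E}$ such that $E_l:=\{(lx,ly)\mid (x,y)\in E\}\subset F$ for every $l\in L$. For $x\in X$, $\iota_x: L\cdot x\to X$ is the inclusion of the orbit and $T^x: L\to L\cdot x$ is $l\mapsto lx$. Further $\iota_x^*(\mathcal{B}_{\mathcal{E}})=\{B\cap L\cdot x\mid B\in\mathcal{B}_{\mathcal{E}}\}$ and $T^x_*(\mathcal{B}_L)=\{T^x(D)\mid D\in\mathcal{B}_L\}$. *)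

theory Defs
  imports "HOL-Algebra.Group_Action"
begin

locale bornological_space =
  fixes X :: "'x set" and B :: "'x set set"
  assumes members_subset: "B \<subseteq> Pow X"
    and covers: "\<Union>B = X"
    and union_closed: "\<lbrakk>S \<in> B; T \<in> B\<rbrakk> \<Longrightarrow> S \<union> T \<in> B"
    and subset_closed: "\<lbrakk>S \<in> B; T \<subseteq> S\<rbrakk> \<Longrightarrow> T \<in> B"

(* No separate condition that f maps the underlying sets into each other is needed: a bornology
   covers its underlying set and consists of subsets of it. *)
definition bornological_map :: "'x set set \<Rightarrow> 'y set set \<Rightarrow> ('x \<Rightarrow> 'y) \<Rightarrow> bool" where
  "bornological_map B C f \<longleftrightarrow> (\<forall>S\<in>B. f ` S \<in> C)"

definition prod_bornology :: "'x set set \<Rightarrow> 'y set set \<Rightarrow> ('x \<times> 'y) set set" where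
  "prod_bornology B C = {S. \<exists>T\<in>B. \<exists>U\<in>C. S \<subseteq> T \<times> U}"

locale bornological_group = group L + bornological_space "carrier L" BL
  for L :: "('l, 'm) monoid_scheme" (structure) and BL :: "'l set set" +
  assumes mult_bornological:
      "bornological_map (prod_bornology BL BL) BL (\<lambda>(g, h). g \<otimes> h)"
    and inv_bornological: "bornological_map BL BL (\<lambda>g. inv g)"

(* An action of L on X is given by a homomorphism from L to the group of bijections of X;
   the point l x of the mathematical notation is "\<phi> l x". *)
locale bornological_action =
  bornological_group L BL + bornological_space X BX + group_action L X \<phi>
  for L :: "('l, 'm) monoid_scheme" (structure) and BL :: "'l set set"
    and X :: "'x set" and BX :: "'x set set" and \<phi> :: "'l \<Rightarrow> 'x \<Rightarrow> 'x" +
  assumes action_bornological: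
    "bornological_map (prod_bornology BL BX) BX (\<lambda>(l, x). \<phi> l x)"

definition transporter ::
    "('l, 'm) monoid_scheme \<Rightarrow> ('l \<Rightarrow> 'x \<Rightarrow> 'x) \<Rightarrow> 'x set \<Rightarrow> 'x set \<Rightarrow> 'l set" where
  "transporter L \<phi> S T = {l \<in> carrier L. \<phi> l ` S \<inter> T \<noteq> {}}"

definition bornological_proper ::
    "('l, 'm) monoid_scheme \<Rightarrow> 'l set set \<Rightarrow> 'x set set \<Rightarrow> ('l \<Rightarrow> 'x \<Rightarrow> 'x) \<Rightarrow> bool" where
  "bornological_proper L BL BX \<phi> \<longleftrightarrow> (\<forall>S\<in>BX. \<forall>T\<in>BX. transporter L \<phi> S T \<in> BL)"

locale coarse_space =
  fixes X :: "'x set" and \<E> :: "('x \<times> 'x) set set"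
  assumes entourages_subset: "\<E> \<subseteq> Pow (X \<times> X)"
    and diag_entourage: "Id_on X \<in> \<E>"
    and transpose_closed: "E \<in> \<E> \<Longrightarrow> E\<inverse> \<in> \<E>"
    and entourage_union_closed: "\<lbrakk>E \<in> \<E>; F \<in> \<E>\<rbrakk> \<Longrightarrow> E \<union> F \<in> \<E>"
    and comp_closed: "\<lbrakk>E \<in> \<E>; F \<in> \<E>\<rbrakk> \<Longrightarrow> E O F \<in> \<E>"
    and entourage_subset_closed: "\<lbrakk>E \<in> \<E>; F \<subseteq> E\<rbrakk> \<Longrightarrow> F \<in> \<E>"

(* The point of A is the second component, so this is the relational image under the
   converse of E and not "E `` A". *)
definition thickening :: "('x \<times> 'x) set \<Rightarrow> 'x set \<Rightarrow> 'x set" where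
  "thickening E A = {y. \<exists>a\<in>A. (y, a) \<in> E}"

definition induced_bornology :: "'x set \<Rightarrow> ('x \<times> 'x) set set \<Rightarrow> 'x set set" where
  "induced_bornology X \<E> =
     {S. S \<subseteq> X \<and> (\<exists>A E. A \<subseteq> X \<and> finite A \<and> E \<in> \<E> \<and> S \<subseteq> thickening E A)}"

definition equi_controlled ::
    "('l, 'm) monoid_scheme \<Rightarrow> ('x \<times> 'x) set set \<Rightarrow> ('l \<Rightarrow> 'x \<Rightarrow> 'x) \<Rightarrow> bool" where
  "equi_controlled L \<E> \<phi> \<longleftrightarrow>
     (\<forall>E\<in>\<E>. \<exists>F\<in>\<E>. \<forall>l\<in>carrier L. {(\<phi> l x, \<phi> l y) | x y. (x, y) \<in> E} \<subseteq> F)"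

definition orbit_restricted_bornology ::
    "('l, 'm) monoid_scheme \<Rightarrow> ('l \<Rightarrow> 'x \<Rightarrow> 'x) \<Rightarrow> 'x \<Rightarrow> 'x set set \<Rightarrow> 'x set set" where
  "orbit_restricted_bornology L \<phi> x B = {S \<inter> orbit L \<phi> x | S. S \<in> B}"

definition orbit_pushforward_bornology ::
    "('l \<Rightarrow> 'x \<Rightarrow> 'x) \<Rightarrow> 'x \<Rightarrow> 'l set set \<Rightarrow> 'x set set" where
  "orbit_pushforward_bornology \<phi> x BL = {(\<lambda>l. \<phi> l x) ` D | D. D \<in> BL}"

end

theory Submission
  imports Defs
begin

text \<open>
  Both directions rest on transporters \<open>{l. l x \<in> T}\<close> out of a single point, whose image under
  the orbit map \<open>l \<mapsto> l x\<close> is the trace of \<open>T\<close> on the orbit of \<open>x\<close>.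

  If the action is proper, then the stabilizer is the transporter from \<open>{x}\<close> to itself, and
  every trace of a bounded set on the orbit is the image of a bounded transporter; conversely
  images of bounded sets under the orbit map are bounded because the action is bornological.

  For the other direction, the condition on the orbits writes the trace of \<open>T\<close> as \<open>D x\<close> with
  \<open>D\<close> bounded, so that the transporter from \<open>{x}\<close> to \<open>T\<close> lies in the bounded set
  \<open>D \<cdot> L\<^sub>x\<close> (lemma \<open>point_transporter_bounded\<close>). General transporters reduce to finitely many
  of these: a bounded \<open>S\<close> lies in an \<open>E\<close>-thickening of a finite set \<open>A\<close>, and equi-control provides
  one entourage \<open>F\<close> such that every \<open>l\<close> with \<open>l s \<in> T\<close> moves the point of \<open>A\<close> near \<open>s\<close>
  into the \<open>F\<inverse>\<close>-thickening of \<open>T\<close> (lemma \<open>transporter_subset_point_transporters\<close>), which is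
  again bounded.
\<close>

lemma (in bornological_space) singleton_bounded:
  assumes "x \<in> X"
  shows "{x} \<in> B"
proof -
  obtain S where "S \<in> B" "x \<in> S"
    using assms covers by blast
  then show ?thesis
    using subset_closed by blast
qed

text \<open>
  Some member is needed to start the induction: the empty family is a bornology on the empty set.
\<close>

lemma (in bornological_space) finite_UN_bounded:
  assumes "finite A" and "B \<noteq> {}" and "\<And>a. a \<in> A \<Longrightarrow> f a \<in> B"
  shows "(\<Union>a\<in>A. f a) \<in> B"
  using assms(1,3)
proof (induction A rule: finite_induct)
  case empty
  then show ?case
    using \<open>B \<noteq> {}\<close> subset_closed by auto
next
  case (insert a A)
  then show ?case
    using union_closed by simp
qed

text \<open>
  An action carries a bornology on the group and one on the space; separate names for the basic
  facts about the first keep the two apart.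
\<close>

lemma (in bornological_group) bounded_subset_carrier: "D \<in> BL \<Longrightarrow> D \<subseteq> carrier L"
  using members_subset by blast

lemma (in bornological_group) subset_of_bounded_group_set: "\<lbrakk>D \<in> BL; K \<subseteq> D\<rbrakk> \<Longrightarrow> K \<in> BL"
  by (rule subset_closed)

lemma (in bornological_group) set_mult_bounded:
  assumes "D \<in> BL" and "K \<in> BL"
  shows "D <#> K \<in> BL"
proof -
  have "D \<times> K \<in> prod_bornology BL BL"
    using assms by (auto simp: prod_bornology_def)
  then have "(\<lambda>(g, h). g \<otimes> h) ` (D \<times> K) \<in> BL"
    using mult_bornological by (simp add: bornological_map_def)
  moreover have "(\<lambda>(g, h). g \<otimes> h) ` (D \<times> K) = D <#> K"
    by (auto simp: set_mult_def)
  ultimately show ?thesis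
    by simp
qed

lemma (in coarse_space) thickening_bounded:
  assumes "T \<in> induced_bornology X \<E>" and "F \<in> \<E>"
  shows "thickening F T \<in> induced_bornology X \<E>"
proof -
  obtain A E where A: "A \<subseteq> X" "finite A" and E: "E \<in> \<E>" and T: "T \<subseteq> thickening E A"
    using assms(1) by (auto simp: induced_bornology_def)
  have "thickening F T \<subseteq> thickening (F O E) A"
    using T by (fastforce simp: thickening_def)
  moreover have "thickening F T \<subseteq> X"
    using assms(2) entourages_subset by (auto simp: thickening_def)
  ultimately show ?thesis
    using A comp_closed[OF assms(2) E] by (auto simp: induced_bornology_def)
qed

context bornological_action
begin

lemma orbit_image_bounded:
  assumes "D \<in> BL" and "x \<in> X"
  shows "(\<lambda>l. \<phi> l x) ` D \<in> BX"
proof -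
  have "{x} \<in> BX"
    by (rule bornological_space.singleton_bounded[OF bornological_space_axioms assms(2)])
  then have "D \<times> {x} \<in> prod_bornology BL BX"
    using assms(1) by (auto simp: prod_bornology_def)
  then have "(\<lambda>(l, y). \<phi> l y) ` (D \<times> {x}) \<in> BX"
    using action_bornological by (simp add: bornological_map_def)
  moreover have "(\<lambda>(l, y). \<phi> l y) ` (D \<times> {x}) = (\<lambda>l. \<phi> l x) ` D"
    by auto
  ultimately show ?thesis
    by simp
qed

lemma orbit_image_transporter:
  "(\<lambda>l. \<phi> l x) ` transporter L \<phi> {x} T = T \<inter> orbit L \<phi> x"
  by (auto simp: transporter_def orbit_def)

lemma orbit_bornology_eq_if_proper:
  assumes proper: "bornological_proper L BL BX \<phi>" and x: "x \<in> X"
  shows "orbit_restricted_bornology L \<phi> x BX = orbit_pushforward_bornology \<phi> x BL"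
proof
  have "{x} \<in> BX"
    by (rule bornological_space.singleton_bounded[OF bornological_space_axioms x])
  then have "transporter L \<phi> {x} S \<in> BL" if "S \<in> BX" for S
    using proper that by (simp add: bornological_proper_def)
  then show "orbit_restricted_bornology L \<phi> x BX \<subseteq> orbit_pushforward_bornology \<phi> x BL"
    unfolding orbit_restricted_bornology_def orbit_pushforward_bornology_def
    by (auto simp: orbit_image_transporter[symmetric])
next
  show "orbit_pushforward_bornology \<phi> x BL \<subseteq> orbit_restricted_bornology L \<phi> x BX"
  proof
    fix S
    assume "S \<in> orbit_pushforward_bornology \<phi> x BL"
    then obtain D where D: "D \<in> BL" and S: "S = (\<lambda>l. \<phi> l x) ` D"
      by (auto simp: orbit_pushforward_bornology_def)
    have "S = S \<inter> orbit L \<phi> x"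
      using bounded_subset_carrier[OF D] by (auto simp: S orbit_def)
    moreover have "S \<in> BX"
      using orbit_image_bounded[OF D x] by (simp add: S)
    ultimately show "S \<in> orbit_restricted_bornology L \<phi> x BX"
      unfolding orbit_restricted_bornology_def by blast
  qed
qed

text \<open>
  Two group elements with the same value under the orbit map differ on the right by an element of
  the stabilizer, so the full preimage of \<open>D x\<close> is \<open>D \<cdot> L\<^sub>x\<close>.
\<close>

lemma point_transporter_bounded:
  assumes x: "x \<in> X" and T: "T \<in> BX"
    and stab: "stabilizer L \<phi> x \<in> BL"
    and orb: "orbit_restricted_bornology L \<phi> x BX = orbit_pushforward_bornology \<phi> x BL"
  shows "transporter L \<phi> {x} T \<in> BL"
proof -
  have "T \<inter> orbit L \<phi> x \<in> orbit_pushforward_bornology \<phi> x BL"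
    using T by (auto simp: orb[symmetric] orbit_restricted_bornology_def)
  then obtain D where D: "D \<in> BL" and trace: "T \<inter> orbit L \<phi> x = (\<lambda>l. \<phi> l x) ` D"
    by (auto simp: orbit_pushforward_bornology_def)
  have "transporter L \<phi> {x} T \<subseteq> D <#> stabilizer L \<phi> x"
  proof
    fix l
    assume "l \<in> transporter L \<phi> {x} T"
    then have l: "l \<in> carrier L" and "\<phi> l x \<in> T \<inter> orbit L \<phi> x"
      by (auto simp: transporter_def orbit_def)
    then obtain d where d: "d \<in> D" and eq: "\<phi> l x = \<phi> d x"
      using trace by auto
    have dL: "d \<in> carrier L"
      using d bounded_subset_carrier[OF D] by blast
    have "\<phi> (inv d \<otimes> l) x = \<phi> (inv d) (\<phi> d x)"
      using composition_rule[OF x _ l] dL eq by simp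
    also have "\<dots> = x"
      using orbit_sym_aux[OF dL x] by simp
    finally have "inv d \<otimes> l \<in> stabilizer L \<phi> x"
      using dL l by (simp add: stabilizer_def)
    moreover have "l = d \<otimes> (inv d \<otimes> l)"
      using dL l by (simp add: m_assoc[symmetric])
    ultimately show "l \<in> D <#> stabilizer L \<phi> x"
      using d by (auto simp: set_mult_def)
  qed
  then show ?thesis
    by (rule subset_of_bounded_group_set[OF set_mult_bounded[OF D stab]])
qed

end

text \<open>
  If \<open>s\<close> is \<open>E\<close>-close to \<open>a\<close> then \<open>l s\<close> and \<open>l a\<close> are \<open>F\<close>-close for every \<open>l\<close>; so an element
  carrying \<open>s\<close> into \<open>T\<close> carries \<open>a\<close> into a thickening of \<open>T\<close>. The converse entourage appears
  because the known point \<open>l s \<in> T\<close> is now the centre.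
\<close>

lemma transporter_subset_point_transporters:
  assumes S: "S \<subseteq> thickening E A"
    and control: "\<And>l. l \<in> carrier L \<Longrightarrow> {(\<phi> l x, \<phi> l y) | x y. (x, y) \<in> E} \<subseteq> F"
  shows "transporter L \<phi> S T \<subseteq> (\<Union>a\<in>A. transporter L \<phi> {a} (thickening (F\<inverse>) T))"
proof
  fix l
  assume "l \<in> transporter L \<phi> S T"
  then obtain s where l: "l \<in> carrier L" and s: "s \<in> S" and lsT: "\<phi> l s \<in> T"
    by (auto simp: transporter_def)
  obtain a where a: "a \<in> A" and "(s, a) \<in> E"
    using s S by (auto simp: thickening_def)
  then have "(\<phi> l s, \<phi> l a) \<in> F"
    using control[OF l] by blast
  then have "\<phi> l a \<in> thickening (F\<inverse>) T"
    using lsT by (auto simp: thickening_def)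
  then show "l \<in> (\<Union>a\<in>A. transporter L \<phi> {a} (thickening (F\<inverse>) T))"
    using l a by (auto simp: transporter_def)
qed

theorem theorem1p13:
  fixes L :: "('l, 'm) monoid_scheme" and BL :: "'l set set"
    and X :: "'x set" and BX :: "'x set set"
    and \<phi> :: "'l \<Rightarrow> 'x \<Rightarrow> 'x" and \<E> :: "('x \<times> 'x) set set"
  assumes "bornological_space X BX"
    and "bornological_group L BL"
    and "bornological_action L BL X BX \<phi>"
    and "coarse_space X \<E>"
    and "BX = induced_bornology X \<E>"
    and "equi_controlled L \<E> \<phi>"
  shows "bornological_proper L BL BX \<phi> \<longleftrightarrow>
    (\<forall>x\<in>X. stabilizer L \<phi> x \<in> BL \<and>
       orbit_restricted_bornology L \<phi> x (induced_bornology X \<E>) =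
         orbit_pushforward_bornology \<phi> x BL)"
proof -
  interpret BX: bornological_space X BX
    by fact
  interpret G: bornological_group L BL
    by fact
  interpret act: bornological_action L BL X BX \<phi>
    by fact
  interpret C: coarse_space X \<E>
    by fact
  show ?thesis
    unfolding assms(5)[symmetric]
  proof (intro iffI ballI conjI)
    fix x
    assume proper: "bornological_proper L BL BX \<phi>" and x: "x \<in> X"
    have "transporter L \<phi> {x} {x} \<in> BL"
      using proper BX.singleton_bounded[OF x] by (simp add: bornological_proper_def)
    then show "stabilizer L \<phi> x \<in> BL"
      by (simp add: transporter_def stabilizer_def eq_commute[of x])
    show "orbit_restricted_bornology L \<phi> x BX = orbit_pushforward_bornology \<phi> x BL"
      using proper x by (rule act.orbit_bornology_eq_if_proper)
  next
    assume orbits: "\<forall>x\<in>X. stabilizer L \<phi> x \<in> BL \<and>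
      orbit_restricted_bornology L \<phi> x BX = orbit_pushforward_bornology \<phi> x BL"
    show "bornological_proper L BL BX \<phi>"
      unfolding bornological_proper_def
    proof (intro ballI)
      fix S T
      assume S: "S \<in> BX" and T: "T \<in> BX"
      obtain A E where A: "A \<subseteq> X" "finite A" and E: "E \<in> \<E>" and SA: "S \<subseteq> thickening E A"
        using S by (auto simp: assms(5) induced_bornology_def)
      obtain F where F: "F \<in> \<E>"
        and control: "\<And>l. l \<in> carrier L \<Longrightarrow> {(\<phi> l x, \<phi> l y) | x y. (x, y) \<in> E} \<subseteq> F"
        using assms(6) E unfolding equi_controlled_def by meson
      have "thickening (F\<inverse>) T \<in> BX"
        using C.thickening_bounded C.transpose_closed[OF F] T assms(5) by blast
      then have "transporter L \<phi> {a} (thickening (F\<inverse>) T) \<in> BL" if "a \<in> A" for a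
        using act.point_transporter_bounded orbits A(1) that by blast
      moreover have "BL \<noteq> {}"
        using G.covers G.one_closed by blast
      ultimately have "(\<Union>a\<in>A. transporter L \<phi> {a} (thickening (F\<inverse>) T)) \<in> BL"
        using A(2) by (intro G.finite_UN_bounded) auto
      then show "transporter L \<phi> S T \<in> BL"
        by (rule G.subset_closed) (rule transporter_subset_point_transporters[OF SA control])
    qed
  qed
qed

end
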